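(* Let $c:\mathbb{R}\to\mathbb{R}^2$ be a smooth curve for which $\dot c(0),\ddot c(0)$ are linearly independent. Then $c$ is a soliton of the mappings $M_\alpha$ for all $\alpha\in(0,1)$, in particular of the midpoints mapping $M=M_{1/2}$, if one of the following holds: (i) $c$ is a curve of constant equi-affine curvature parametrized proportional to equi-affine arc length; or (ii) $c$ is, up to an affine transformation of $\mathbb{R}^2$, the parabola with the parametrization $c(t)=(\exp(t),\exp(2t))$; or (iii) $c$ is a curve of constant general-affine curvature parametrized proportional to general-affine arc length.
   Context: $\mathrm{Aff}(2)$ is the group of affine maps $(A,b):x\mapsto Ax+b$ of $\mathbb{R}^2$ with $A\in\mathrm{GL}(2,\mathbb{R})$, $b\in\mathbb{R}^2$. For $\alpha\in(0,1)$, a smooth curve $c:\mathbb{R}\to\mathbb{R}^2$ is called a soliton of the mapping $M_\alpha$ if there are $\epsilon>0$ and a smooth map $s\in(-\epsilon,\epsilon)\mapsto(A(s),b(s))\in\mathrm{Aff}(2)$ such that $(1-\alpha)c(t)+\alpha c(t+s)=A(s)c(t)+b(s)$ for all $s\in(-\epsilon,\epsilon)$ and $t\in\mathbb{R}$. For $x,y\in\mathbb{R}^2$, $|x\ \ y|$ denotes the determinant of the matrix with columns $x,y$. Equi-affine and general-affine notions are defined for smooth plane curves $c:I\to\mathbb{R}^2$ with $|\dot c(t)\ \ \ddot c(t)|\neq0$ for all $t\in I$ (so this is part of conditions (i) and (iii)); changing the orientation of the curve if necessary (replacing $t$ by $-t$), one assumes $|\dot c(t)\ \ \ddot c(t)|>0$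 for all $t$. The equi-affine arc length is $s_{ea}(t)=\int|\dot c(t)\ \ \ddot c(t)|^{1/3}\,dt$ (up to an additive constant). With $t=t(s_{ea})$ the inverse function, $\tilde c(s_{ea})=c(t(s_{ea}))$ is the parametrization by equi-affine arc length. Then $\tilde c'''$ and $\tilde c'$ are linearly dependent, and the equi-affine curvature $k_{ea}$ is defined by $\tilde c'''(s_{ea})=-k_{ea}(s_{ea})\,\tilde c'(s_{ea})$. The curve is parametrized proportional to equi-affine arc length if $t=\lambda_1s_{ea}+\lambda_2$ for constants $\lambda_1\neq0$, $\lambda_2\in\mathbb{R}$. If the sign of $k_{ea}$ is constant and non-zero (which is part of condition (iii)), put $K_{ea}=|k_{ea}|$. The general-affine arc length is $s_{ga}=\int\sqrt{K_{ea}(s_{ea})}\,ds_{ea}$ (up to an additive constant), and the general-affine curvature is $k_{ga}=K_{ea}'K_{ea}^{-3/2}=-2(K_{ea}^{-1/2})'$, where $'$ is differentiation with respect to $s_{ea}$. The curve is parametrized proportional to general-affine arc length if $t=\lambda_1s_{ga}+\lambda_2$ for constants $\lambda_1\neq0$, $\lambda_2\in\mathbb{R}$. *)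

theory Defs
  imports "HOL-Analysis.Analysis"
begin

section \<open>Smooth curves\<close>

definition nth_vector_derivative :: "nat \<Rightarrow> (real \<Rightarrow> 'a::real_normed_vector) \<Rightarrow> real \<Rightarrow> 'a" where
  "nth_vector_derivative n f = ((\<lambda>g t. vector_derivative g (at t)) ^^ n) f"

text \<open>\<open>C\<^sup>\<infinity>\<close> on \<open>S\<close>. The derivatives are two-sided, so this is meant for open \<open>S\<close>.\<close>

definition smooth_on :: "real set \<Rightarrow> (real \<Rightarrow> 'a::real_normed_vector) \<Rightarrow> bool" where
  "smooth_on S f \<longleftrightarrow> (\<forall>n. \<forall>t\<in>S. nth_vector_derivative n f differentiable (at t))"

text \<open>Linear independence of the pair \<open>x\<close>, \<open>y\<close>. This is not \<open>independent {x, y}\<close>, which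
  holds for \<open>x = y \<noteq> 0\<close>.\<close>

definition lin_indep_pair :: "'a::real_vector \<Rightarrow> 'a \<Rightarrow> bool" where
  "lin_indep_pair x y \<longleftrightarrow> (\<forall>a b. a *\<^sub>R x + b *\<^sub>R y = 0 \<longrightarrow> a = 0 \<and> b = 0)"

section \<open>Affine maps and solitons\<close>

definition Aff2 :: "((real^2^2) \<times> (real^2)) set" where
  "Aff2 = {(A, b). invertible A}"

definition aff_apply :: "(real^2^2) \<times> (real^2) \<Rightarrow> real^2 \<Rightarrow> real^2" where
  "aff_apply g x = fst g *v x + snd g"

definition soliton :: "real \<Rightarrow> (real \<Rightarrow> real^2) \<Rightarrow> bool" where
  "soliton \<alpha> c \<longleftrightarrow> smooth_on UNIV c \<and>
    (\<exists>\<epsilon>>0. \<exists>g :: real \<Rightarrow> (real^2^2) \<times> (real^2).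
      smooth_on {-\<epsilon><..<\<epsilon>} g \<and>
      (\<forall>s\<in>{-\<epsilon><..<\<epsilon>}. g s \<in> Aff2) \<and>
      (\<forall>s\<in>{-\<epsilon><..<\<epsilon>}. \<forall>t. (1 - \<alpha>) *\<^sub>R c t + \<alpha> *\<^sub>R c (t + s) = aff_apply (g s) (c t)))"

section \<open>Equi-affine invariants\<close>

text \<open>The determinant of the matrix with columns \<open>x\<close>, \<open>y\<close>; \<open>vector [x, y]\<close> has them as rows.\<close>

definition det_cols :: "real^2 \<Rightarrow> real^2 \<Rightarrow> real" where
  "det_cols x y = det (transpose (vector [x, y] :: real^2^2))"

definition velacc_det :: "(real \<Rightarrow> real^2) \<Rightarrow> real \<Rightarrow> real" where
  "velacc_det c t = det_cols (nth_vector_derivative 1 c t) (nth_vector_derivative 2 c t)"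

definition ea_regular :: "(real \<Rightarrow> real^2) \<Rightarrow> bool" where
  "ea_regular c \<longleftrightarrow> (\<forall>t. velacc_det c t \<noteq> 0)"

text \<open>For a smooth \<open>ea_regular\<close> curve, \<open>velacc_det\<close> has constant sign, and reversing the
  orientation changes that sign. The equi-affine and general-affine notions below are
  meant for smooth curves \<open>c\<close> with \<open>velacc_det c > 0\<close>, and are applied to \<open>pos_oriented c\<close>
  in general.\<close>

definition pos_oriented :: "(real \<Rightarrow> real^2) \<Rightarrow> real \<Rightarrow> real^2" where
  "pos_oriented c = (if \<forall>t. velacc_det c t > 0 then c else (\<lambda>t. c (- t)))"

text \<open>The arc length is normalised to vanish at parameter \<open>0\<close>; the integral is signed.\<close>

definition ea_arclength :: "(real \<Rightarrow> real^2) \<Rightarrow> real \<Rightarrow> real" where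
  "ea_arclength c t = (LBINT u=ereal 0..ereal t. velacc_det c u powr (1/3))"

text \<open>Only meaningful on the open interval \<open>range (ea_arclength c)\<close>, which need not be
  all of \<open>\<real>\<close>; the same applies to the functions of equi-affine arc length below.\<close>

definition ea_reparam :: "(real \<Rightarrow> real^2) \<Rightarrow> real \<Rightarrow> real^2" where
  "ea_reparam c = c \<circ> inv (ea_arclength c)"

definition ea_curvature :: "(real \<Rightarrow> real^2) \<Rightarrow> real \<Rightarrow> real" where
  "ea_curvature c s = (THE k. nth_vector_derivative 3 (ea_reparam c) s =
      - k *\<^sub>R nth_vector_derivative 1 (ea_reparam c) s)"

definition constant_ea_curvature :: "(real \<Rightarrow> real^2) \<Rightarrow> bool" where
  "constant_ea_curvature c \<longleftrightarrow> (\<exists>\<kappa>. \<forall>s\<in>range (ea_arclength c). ea_curvature c s = \<kappa>)"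

definition proportional_to_ea_arclength :: "(real \<Rightarrow> real^2) \<Rightarrow> bool" where
  "proportional_to_ea_arclength c \<longleftrightarrow>
    (\<exists>l\<^sub>1 l\<^sub>2. l\<^sub>1 \<noteq> 0 \<and> (\<forall>t. t = l\<^sub>1 * ea_arclength c t + l\<^sub>2))"

section \<open>General-affine invariants\<close>

definition ea_curvature_sign_constant :: "(real \<Rightarrow> real^2) \<Rightarrow> bool" where
  "ea_curvature_sign_constant c \<longleftrightarrow>
    (\<forall>s\<in>range (ea_arclength c). ea_curvature c s > 0) \<or>
    (\<forall>s\<in>range (ea_arclength c). ea_curvature c s < 0)"

definition abs_ea_curvature :: "(real \<Rightarrow> real^2) \<Rightarrow> real \<Rightarrow> real" where
  "abs_ea_curvature c s = \<bar>ea_curvature c s\<bar>"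

text \<open>General-affine arc length and curvature as functions of equi-affine arc length.\<close>

definition ga_arclength :: "(real \<Rightarrow> real^2) \<Rightarrow> real \<Rightarrow> real" where
  "ga_arclength c s = (LBINT u=ereal 0..ereal s. sqrt (abs_ea_curvature c u))"

definition ga_curvature :: "(real \<Rightarrow> real^2) \<Rightarrow> real \<Rightarrow> real" where
  "ga_curvature c s = deriv (abs_ea_curvature c) s * abs_ea_curvature c s powr (-3/2)"

definition constant_ga_curvature :: "(real \<Rightarrow> real^2) \<Rightarrow> bool" where
  "constant_ga_curvature c \<longleftrightarrow> (\<exists>\<kappa>. \<forall>s\<in>range (ea_arclength c). ga_curvature c s = \<kappa>)"

definition proportional_to_ga_arclength :: "(real \<Rightarrow> real^2) \<Rightarrow> bool" where
  "proportional_to_ga_arclength c \<longleftrightarrow>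
    (\<exists>l\<^sub>1 l\<^sub>2. l\<^sub>1 \<noteq> 0 \<and> (\<forall>t. t = l\<^sub>1 * ga_arclength c (ea_arclength c t) + l\<^sub>2))"

end

theory Submission
  imports Defs
begin

text \<open>In each of the three cases the curve satisfies \<open>c''' = a c'' + b c'\<close> with constant \<open>a\<close>, \<open>b\<close>.
  Let \<open>w\<close> be the speed of the equi-affine arc length and \<open>k\<close> the equi-affine curvature as a function
  of the parameter. The curve satisfies
  \<open>c''' = 3 (w'/w) c'' + (w''/w - 3 (w'/w)\<^sup>2 - k w\<^sup>2) c'\<close>.
  In case (i) both \<open>w\<close> and \<open>k\<close> are constant. In case (iii) proportionality to general-affine arc
  length makes \<open>k w\<^sup>2\<close> constant, and then constancy of the general-affine curvature makes \<open>w'/w\<close>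
  constant.\<close>

section \<open>Smooth curves and determinants\<close>

lemma nth_vector_derivative_0: "nth_vector_derivative 0 f = f"
  by (simp add: nth_vector_derivative_def)

lemma nth_vector_derivative_Suc:
  "nth_vector_derivative (Suc n) f = (\<lambda>t. vector_derivative (nth_vector_derivative n f) (at t))"
  by (simp add: nth_vector_derivative_def)

lemma smooth_on_has_vector_derivative:
  assumes "smooth_on UNIV f"
  shows "(nth_vector_derivative n f has_vector_derivative nth_vector_derivative (Suc n) f t) (at t)"
  using assms by (simp add: smooth_on_def nth_vector_derivative_Suc vector_derivative_works)

lemma smooth_on_subset: "smooth_on S f \<Longrightarrow> T \<subseteq> S \<Longrightarrow> smooth_on T f"
  by (auto simp: smooth_on_def)

text \<open>A whole candidate sequence \<open>h\<close> of derivatives is verified in one step. The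
  same hypothesis also yields smoothness in \<open>smooth_onI\<close>, so reflected curves, affine
  motions and the parabola are handled by exhibiting \<open>h\<close>.\<close>

lemma nth_vector_derivative_eqI:
  assumes "\<And>n t. (h n has_vector_derivative h (Suc n) t) (at t)"
  shows "nth_vector_derivative n (h 0) = h n"
proof (induction n)
  case (Suc n)
  show ?case
    unfolding nth_vector_derivative_Suc Suc
    by (rule ext) (rule vector_derivative_at[OF assms])
qed (simp add: nth_vector_derivative_0)

lemma smooth_onI:
  assumes "\<And>n t. (h n has_vector_derivative h (Suc n) t) (at t)"
  shows "smooth_on UNIV (h 0)"
  unfolding smooth_on_def nth_vector_derivative_eqI[of h, OF assms]
  using assms differentiableI_vector by blast

text \<open>Serves for the reversal of orientation, where \<open>r\<close> is -1.\<close>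

lemma
  fixes f :: "real \<Rightarrow> 'a::real_normed_vector"
  assumes "smooth_on UNIV f"
  shows nth_vector_derivative_scale:
      "nth_vector_derivative n (\<lambda>t. f (r * t)) = (\<lambda>t. r ^ n *\<^sub>R nth_vector_derivative n f (r * t))"
    and smooth_on_scale: "smooth_on UNIV (\<lambda>t. f (r * t))"
proof -
  define h where "h = (\<lambda>n t. r ^ n *\<^sub>R nth_vector_derivative n f (r * t))"
  have h0: "(\<lambda>t. f (r * t)) = h 0"
    by (simp add: h_def nth_vector_derivative_0)
  have h: "(h n has_vector_derivative h (Suc n) t) (at t)" for n t
  proof -
    have "((\<lambda>t. r * t) has_vector_derivative r) (at t)"
      by (auto intro!: derivative_eq_intros simp flip: has_real_derivative_iff_has_vector_derivative)
    from vector_diff_chain_at[OF this smooth_on_has_vector_derivative[OF assms, of n]]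
    have "((\<lambda>t. nth_vector_derivative n f (r * t)) has_vector_derivative
        r *\<^sub>R nth_vector_derivative (Suc n) f (r * t)) (at t)"
      by (simp add: o_def)
    from has_vector_derivative_scaleR[OF DERIV_const[of "r ^ n"] this]
    show ?thesis by (simp add: h_def mult.commute)
  qed
  show "nth_vector_derivative n (\<lambda>t. f (r * t)) = (\<lambda>t. r ^ n *\<^sub>R nth_vector_derivative n f (r * t))"
    using nth_vector_derivative_eqI[of h n, OF h] h0 by (simp add: h_def)
  show "smooth_on UNIV (\<lambda>t. f (r * t))"
    using smooth_onI[of h, OF h] h0 by simp
qed

lemma continuous_on_vector_derivative:
  assumes "\<And>t. (f has_vector_derivative f' t) (at t)"
  shows "continuous_on A f"
  by (rule continuous_at_imp_continuous_on) (auto intro: has_vector_derivative_continuous[OF assms])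

lemma continuous_on_real_derivative:
  assumes "\<And>t. (f has_real_derivative f' t) (at t)"
  shows "continuous_on A f"
  by (rule DERIV_continuous_on) (rule has_field_derivative_at_within[OF assms])

lemma det_cols_eq: "det_cols x y = x$1 * y$2 - x$2 * y$1"
  by (simp add: det_cols_def det_2 transpose_def)

lemma bounded_bilinear_det_cols: "bounded_bilinear det_cols"
proof -
  have "bilinear det_cols"
    by (auto simp: bilinear_def det_cols_eq algebra_simps intro!: linearI)
  then show ?thesis by (simp add: bilinear_conv_bounded_bilinear)
qed

lemmas det_cols_has_derivative =
  bounded_bilinear.has_vector_derivative[OF bounded_bilinear_det_cols,
    folded has_real_derivative_iff_has_vector_derivative]
lemmas continuous_on_det_cols =
  bounded_bilinear.continuous_on[OF bounded_bilinear_det_cols]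

text \<open>Cramer's rule: multiplied by the determinant, this is a polynomial identity in the
  coordinates.\<close>

lemma det_cols_cramer:
  assumes "det_cols x y \<noteq> 0"
  shows "z = (det_cols z y / det_cols x y) *\<^sub>R x + (det_cols x z / det_cols x y) *\<^sub>R y"
proof -
  have "det_cols x y *\<^sub>R z = det_cols z y *\<^sub>R x + det_cols x z *\<^sub>R y"
    by (simp add: vec_eq_iff forall_2 det_cols_eq algebra_simps)
  then have "(1 / det_cols x y) *\<^sub>R (det_cols x y *\<^sub>R z)
      = (1 / det_cols x y) *\<^sub>R (det_cols z y *\<^sub>R x + det_cols x z *\<^sub>R y)" by simp
  then show ?thesis using assms by (simp add: scaleR_add_right)
qed

lemma lin_indep_pair_imp_det_cols:
  fixes x y :: "real^2"
  assumes "lin_indep_pair x y"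
  shows "det_cols x y \<noteq> 0"
proof
  assume d: "det_cols x y = 0"
  \<comment> \<open>In each combination one coordinate cancels identically and the other is the
    determinant up to sign. Independence then kills both coordinates of \<open>x\<close>.\<close>
  have "y$1 *\<^sub>R x + (- x$1) *\<^sub>R y = 0" "y$2 *\<^sub>R x + (- x$2) *\<^sub>R y = 0"
    using d by (auto simp: vec_eq_iff forall_2 det_cols_eq algebra_simps)
  then have "y$1 = 0 \<and> - x$1 = 0" "y$2 = 0 \<and> - x$2 = 0"
    using assms unfolding lin_indep_pair_def by blast+
  then have "x = 0" by (auto simp: vec_eq_iff forall_2)
  then have "1 *\<^sub>R x + 0 *\<^sub>R y = 0" by simp
  then show False using assms unfolding lin_indep_pair_def by (metis zero_neq_one)
qed

section \<open>Curves with constant-coefficient third-order equation\<close>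

text \<open>For t \<ge> 0 the weight exp(-C t) makes the product with \<open>e\<close>
  nonincreasing; for t \<le> 0 the weight exp(C t) makes it nondecreasing. Either way
  \<open>e t\<close> is squeezed between 0 and a multiple of \<open>e 0\<close>.\<close>

lemma gronwall_zero:
  fixes e e' :: "real \<Rightarrow> real"
  assumes "\<And>t. (e has_real_derivative e' t) (at t)"
    and "\<And>t. \<bar>e' t\<bar> \<le> C * e t" and "\<And>t. e t \<ge> 0" and "e 0 = 0"
  shows "e t = 0"
proof (cases "t \<ge> 0")
  case True
  have "(\<lambda>t. e t * exp (- C * t)) t \<le> (\<lambda>t. e t * exp (- C * t)) 0"
  proof (rule DERIV_nonpos_imp_nonincreasing[OF True])
    fix x
    have "((\<lambda>t. e t * exp (- C * t)) has_real_derivative (e' x - C * e x) * exp (- C * x)) (at x)"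
      by (auto intro!: derivative_eq_intros assms(1) simp: algebra_simps)
    moreover have "(e' x - C * e x) * exp (- C * x) \<le> 0"
      using assms(2)[of x] by (intro mult_nonpos_nonneg) auto
    ultimately show "\<exists>y. ((\<lambda>t. e t * exp (- C * t)) has_real_derivative y) (at x) \<and> y \<le> 0"
      by blast
  qed
  then have "e t * exp (- C * t) \<le> 0" using assms(4) by simp
  then show ?thesis using assms(3)[of t] by (simp add: mult_le_0_iff)
next
  case False
  then have "t \<le> 0" by simp
  then have "(\<lambda>t. e t * exp (C * t)) t \<le> (\<lambda>t. e t * exp (C * t)) 0"
  proof (rule DERIV_nonneg_imp_nondecreasing)
    fix x
    have "((\<lambda>t. e t * exp (C * t)) has_real_derivative (e' x + C * e x) * exp (C * x)) (at x)"
      by (auto intro!: derivative_eq_intros assms(1) simp: algebra_simps)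
    moreover have "(e' x + C * e x) * exp (C * x) \<ge> 0"
      using assms(2)[of x] by (intro mult_nonneg_nonneg) auto
    ultimately show "\<exists>y. ((\<lambda>t. e t * exp (C * t)) has_real_derivative y) (at x) \<and> 0 \<le> y"
      by blast
  qed
  then have "e t * exp (C * t) \<le> 0" using assms(4) by simp
  then show ?thesis using assms(3)[of t] by (simp add: mult_le_0_iff)
qed

text \<open>Uniqueness for the linear equation through the energy |u|^2 + |u'|^2, which obeys a
  Gronwall inequality.\<close>

lemma linear_ode2_zero:
  fixes u u' :: "real \<Rightarrow> 'a::real_inner"
  assumes u: "\<And>t. (u has_vector_derivative u' t) (at t)"
    and u': "\<And>t. (u' has_vector_derivative a *\<^sub>R u' t + b *\<^sub>R u t) (at t)"
    and "u 0 = 0" "u' 0 = 0"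
  shows "u t = 0"
proof -
  define e where "e = (\<lambda>t. u t \<bullet> u t + u' t \<bullet> u' t)"
  define e' where "e' = (\<lambda>t. 2 * (1 + b) * (u t \<bullet> u' t) + 2 * a * (u' t \<bullet> u' t))"
  note inner = bounded_bilinear.has_vector_derivative[OF bounded_bilinear_inner]
  have "e t = 0"
  \<comment> \<open>The constant comes from 2 |u . u'| \<le> e and |u'|^2 \<le> e, applied to the
    two terms of \<open>e'\<close>.\<close>
  proof (rule gronwall_zero[where e = e and e' = e' and C = "\<bar>1 + b\<bar> + 2 * \<bar>a\<bar>"])
    fix t
    show "(e has_real_derivative e' t) (at t)"
      unfolding has_real_derivative_iff_has_vector_derivative e_def
      by (rule has_vector_derivative_eq_rhs[OF
            has_vector_derivative_add[OF inner[OF u u] inner[OF u' u']]])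
         (simp add: e'_def algebra_simps inner_commute)
    show "e t \<ge> 0" by (simp add: e_def)
    have 1: "\<bar>2 * (u t \<bullet> u' t)\<bar> \<le> e t"
    proof -
      have "(u t + u' t) \<bullet> (u t + u' t) \<ge> 0" "(u t - u' t) \<bullet> (u t - u' t) \<ge> 0" by simp_all
      then show ?thesis
        by (simp add: e_def inner_add_left inner_add_right inner_diff_left inner_diff_right inner_commute)
    qed
    have 2: "\<bar>u' t \<bullet> u' t\<bar> \<le> e t" by (simp add: e_def)
    have "\<bar>e' t\<bar> \<le> \<bar>1 + b\<bar> * \<bar>2 * (u t \<bullet> u' t)\<bar> + 2 * \<bar>a\<bar> * \<bar>u' t \<bullet> u' t\<bar>"
    proof -
      have "e' t = (1 + b) * (2 * (u t \<bullet> u' t)) + 2 * a * (u' t \<bullet> u' t)"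
        by (simp add: e'_def algebra_simps)
      then show ?thesis
        using abs_triangle_ineq[of "(1 + b) * (2 * (u t \<bullet> u' t))" "2 * a * (u' t \<bullet> u' t)"]
        unfolding abs_mult by simp
    qed
    also have "\<dots> \<le> \<bar>1 + b\<bar> * e t + 2 * \<bar>a\<bar> * e t"
      using 1 2 by (intro add_mono mult_left_mono) auto
    finally show "\<bar>e' t\<bar> \<le> (\<bar>1 + b\<bar> + 2 * \<bar>a\<bar>) * e t" by (simp add: algebra_simps)
  qed (simp add: e_def assms)
  then show ?thesis unfolding e_def
    by (metis add_nonneg_eq_0_iff inner_eq_zero_iff inner_ge_zero)
qed

lemma has_vector_derivative_shift:
  fixes f :: "real \<Rightarrow> 'a::real_normed_vector"
  assumes "(f has_vector_derivative D) (at (t + s))"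
  shows "((\<lambda>t. f (t + s)) has_vector_derivative D) (at t)"
proof -
  have "((\<lambda>t. t + s) has_vector_derivative 1) (at t)"
    by (auto intro!: derivative_eq_intros)
  from vector_diff_chain_at[OF this] assms show ?thesis by (fastforce simp: o_def)
qed

text \<open>The translates of the velocity solve the same linear equation as the velocity, so they are
  its images under linear maps, and translation in the parameter is an affine motion of the curve.\<close>

lemma soliton_of_linear_ode3:
  fixes c :: "real \<Rightarrow> real^2"
  assumes smooth: "smooth_on UNIV c"
    and indep: "lin_indep_pair (nth_vector_derivative 1 c 0) (nth_vector_derivative 2 c 0)"
    and ode: "\<And>t. nth_vector_derivative 3 c t =
        a *\<^sub>R nth_vector_derivative 2 c t + b *\<^sub>R nth_vector_derivative 1 c t"
  shows "soliton \<alpha> c"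
proof -
  define d where "d = (\<lambda>n. nth_vector_derivative n c)"
  define \<delta> where "\<delta> = det_cols (d 1 0) (d 2 0)"
  \<comment> \<open>By Cramer's rule \<open>M y z\<close> is the linear map taking the velocity at 0
    to \<open>y\<close> and the acceleration at 0 to \<open>z\<close>. Thus \<open>P s\<close>
    carries the initial velocity and acceleration to those at \<open>s\<close>.\<close>
  define M :: "real^2 \<Rightarrow> real^2 \<Rightarrow> real^2^2" where "M = (\<lambda>y z.
    matrix (\<lambda>x. (det_cols x (d 2 0) / \<delta>) *\<^sub>R y + (det_cols (d 1 0) x / \<delta>) *\<^sub>R z))"
  define P where "P = (\<lambda>s. M (d 1 s) (d 2 s))"
  have \<delta>: "\<delta> \<noteq> 0"
    using lin_indep_pair_imp_det_cols[OF indep] by (simp add: \<delta>_def d_def)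
  have d: "(d n has_vector_derivative d (Suc n) t) (at t)" for n t
    unfolding d_def by (rule smooth_on_has_vector_derivative[OF smooth])
  have d0: "d 0 = c" by (simp add: d_def nth_vector_derivative_0)
  have d12: "(d 1 has_vector_derivative d 2 t) (at t)"
    and d23: "(d 2 has_vector_derivative a *\<^sub>R d 2 t + b *\<^sub>R d 1 t) (at t)"
    and d01: "(c has_vector_derivative d 1 t) (at t)" for t
    using d[of 1 t] d[of 2 t] d[of 0 t] ode[of t] d0
    by (simp_all add: d_def numeral_2_eq_2 numeral_3_eq_3)
  have M_apply: "M y z *v x = (det_cols x (d 2 0) / \<delta>) *\<^sub>R y + (det_cols (d 1 0) x / \<delta>) *\<^sub>R z"
    for x y z
    unfolding M_def
    by (intro matrix_works)
       (auto intro!: linearI simp: linear_matrix_vector_mul_eq det_cols_eq algebra_simps diff_divide_distrib add_divide_distrib)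
  have M_add: "M (y + y') (z + z') = M y z + M y' z'"
    and M_scale: "M (r *\<^sub>R y) (r *\<^sub>R z) = r *\<^sub>R M y z" for y z y' z' r
    by (simp_all add: M_def matrix_def vec_eq_iff algebra_simps add_divide_distrib)
  have det_self: "det_cols x x = 0" for x by (simp add: det_cols_eq)
  have P_mv_derivative: "((\<lambda>t. P s *v f t) has_vector_derivative P s *v f') (at t)"
    if "(f has_vector_derivative f') (at t)" for f f' s t
    by (rule bounded_linear.has_vector_derivative[OF matrix_vector_mul_bounded_linear that])
  have vel: "d 1 (t + s) = P s *v d 1 t" for s t
  proof -
    define u where "u = (\<lambda>t. d 1 (t + s) - P s *v d 1 t)"
    define u' where "u' = (\<lambda>t. d 2 (t + s) - P s *v d 2 t)"
    \<comment> \<open>By linearity \<open>u\<close> solves the same second-order equation as the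
      velocity, and the choice of \<open>P s\<close> makes its initial data vanish.\<close>
    have "u t = 0"
    proof (rule linear_ode2_zero[where u = u and u' = u' and a = a and b = b])
      fix t
      show "(u has_vector_derivative u' t) (at t)"
        unfolding u_def u'_def
        by (intro has_vector_derivative_diff has_vector_derivative_shift P_mv_derivative d12)
      show "(u' has_vector_derivative a *\<^sub>R u' t + b *\<^sub>R u t) (at t)"
        unfolding u_def u'_def
        by (rule has_vector_derivative_eq_rhs[OF has_vector_derivative_diff[OF
                has_vector_derivative_shift[OF d23] P_mv_derivative[OF d23]]])
           (simp add: algebra_simps matrix_vector_right_distrib)
    next
      show "u 0 = 0" "u' 0 = 0"
        using \<delta> unfolding u_def u'_def P_def M_apply by (simp_all add: \<delta>_def det_self)
    qed
    then show ?thesis by (simp add: u_def)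
  qed
  \<comment> \<open>The translation is forced by the value at t = 0; equality of velocities then
    gives the motion for all t.\<close>
  define B where "B = (\<lambda>s. c s - P s *v c 0)"
  have motion: "c (t + s) = P s *v c t + B s" for s t
  proof -
    define u where "u = (\<lambda>t. c (t + s) - P s *v c t)"
    have "(u has_vector_derivative 0) (at t)" for t
      unfolding u_def
      by (rule has_vector_derivative_eq_rhs[OF has_vector_derivative_diff[OF
              has_vector_derivative_shift[OF d01] P_mv_derivative[OF d01]]])
         (simp add: vel del: One_nat_def)
    then have "u t = u 0"
      using has_vector_derivative_zero_constant[of UNIV u] by (metis UNIV_I convex_UNIV)
    then show ?thesis by (simp add: u_def B_def algebra_simps)
  qed
  \<comment> \<open>Since \<open>M\<close> is jointly linear in its arguments, the non-constant part
    of the affine map is a fixed linear image of (c, c', c''). Each of its derivatives is thus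
    obtained by raising the index of \<open>d\<close>; the constant part survives only for n =
    0.\<close>
  define L where "L = (\<lambda>(x, y, z). (\<alpha> *\<^sub>R M y z, \<alpha> *\<^sub>R (x - M y z *v c 0)))"
  have "linear L"
    by (rule linearI) (auto simp: L_def M_add M_scale algebra_simps scaleR_matrix_vector_assoc[symmetric]
        matrix_vector_mult_add_rdistrib)
  then have L: "bounded_linear L" by (simp add: linear_conv_bounded_linear)
  define h where "h = (\<lambda>n s. (if n = 0 then ((1 - \<alpha>) *\<^sub>R mat 1, 0) else 0)
    + L (d n s, d (n + 1) s, d (n + 2) s))"
  have h: "(h n has_vector_derivative h (Suc n) t) (at t)" for n t
  proof -
    have "((\<lambda>s. L (d n s, d (n + 1) s, d (n + 2) s)) has_vector_derivative
        L (d (Suc n) t, d (Suc n + 1) t, d (Suc n + 2) t)) (at t)"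
      using d[of n t] d[of "n + 1" t] d[of "n + 2" t]
      by (intro bounded_linear.has_vector_derivative[OF L] has_vector_derivative_Pair) simp_all
    from has_vector_derivative_add[OF has_vector_derivative_const this]
    show ?thesis by (simp add: h_def)
  qed
  define g where "g = h 0"
  have g: "g s = ((1 - \<alpha>) *\<^sub>R mat 1 + \<alpha> *\<^sub>R P s, \<alpha> *\<^sub>R B s)" for s
    by (simp add: g_def h_def L_def P_def B_def d0 numeral_2_eq_2)
  \<comment> \<open>At s = 0 the linear part is the identity for every \<alpha>, so by continuity
    its determinant stays non-zero for small s. This is where \<epsilon> comes from.\<close>
  have "P 0 *v x = x" for x
    using det_cols_cramer[of "d 1 0" "d 2 0" x] \<delta> unfolding P_def M_apply \<delta>_def by simp
  then have P0: "P 0 = mat 1"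
    by (metis matrix_eq matrix_vector_mul_lid)
  have "continuous_on UNIV g"
    unfolding g_def by (rule continuous_on_vector_derivative[OF h])
  then have "continuous_on UNIV (\<lambda>s. fst (g s))" by (intro continuous_intros)
  then have "continuous_on UNIV (\<lambda>s. det (fst (g s)))"
    unfolding det_2 by (auto intro!: continuous_on_diff continuous_on_mult continuous_on_component)
  moreover have "det (fst (g 0)) = 1"
    by (simp add: g P0 flip: scaleR_add_left)
  ultimately have "((\<lambda>s. det (fst (g s))) \<longlongrightarrow> 1) (at 0)"
    by (metis UNIV_I continuous_on_def)
  then have "\<forall>\<^sub>F s in at 0. det (fst (g s)) \<noteq> 0"
    by (rule tendsto_imp_eventually_ne) simp
  then obtain \<epsilon> where \<epsilon>: "\<epsilon> > 0" "\<And>s. s \<noteq> 0 \<Longrightarrow> dist s 0 < \<epsilon> \<Longrightarrow> det (fst (g s)) \<noteq> 0"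
    unfolding eventually_at by auto
  have "g s \<in> Aff2" if "s \<in> {-\<epsilon><..<\<epsilon>}" for s
  proof -
    \<comment> \<open>The filter at 0 omits the point itself, so s = 0 is treated
      separately.\<close>
    have "det (fst (g s)) \<noteq> 0"
      using that \<epsilon>(2)[of s] \<open>det (fst (g 0)) = 1\<close> by (cases "s = 0") (auto simp: abs_less_iff)
    then show ?thesis by (auto simp: Aff2_def g invertible_det_nz)
  qed
  moreover have "(1 - \<alpha>) *\<^sub>R c t + \<alpha> *\<^sub>R c (t + s) = aff_apply (g s) (c t)" for s t
    unfolding motion by (simp add: aff_apply_def g algebra_simps matrix_vector_mult_add_rdistrib
        flip: scaleR_matrix_vector_assoc)
  moreover have "smooth_on {-\<epsilon><..<\<epsilon>} g"
    using smooth_on_subset[OF smooth_onI[of h, OF h]] g_def by blast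
  ultimately show ?thesis
    unfolding soliton_def using smooth \<open>\<epsilon> > 0\<close> by blast
qed

section \<open>The parabola with exponential parametrization\<close>

lemma nth_vector_derivative_affine_parabola:
  assumes "\<And>t. c t = aff_apply g (vector [exp t, exp (2 * t)])"
  shows "nth_vector_derivative n c t =
    fst g *v vector [exp t, 2 ^ n * exp (2 * t)] + (if n = 0 then snd g else 0)"
proof -
  define h where "h = (\<lambda>n t. fst g *v (vector [exp t, 2 ^ n * exp (2 * t)] :: real^2)
    + (if n = 0 then snd g else 0))"
  have vec: "(vector [x, y] :: real^2) = x *\<^sub>R axis 1 1 + y *\<^sub>R axis 2 1" for x y :: real
    by (simp add: vec_eq_iff forall_2 axis_def)
  have h: "(h n has_vector_derivative h (Suc n) t) (at t)" for n t
  proof -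
    have e: "(exp has_vector_derivative exp t) (at t)"
      "((\<lambda>t. 2 ^ n * exp (2 * t)) has_vector_derivative 2 ^ Suc n * exp (2 * t)) (at t)"
      unfolding has_real_derivative_iff_has_vector_derivative[symmetric]
      by (auto intro!: derivative_eq_intros)
    have "((\<lambda>t. vector [exp t, 2 ^ n * exp (2 * t)] :: real^2) has_vector_derivative
        vector [exp t, 2 ^ Suc n * exp (2 * t)]) (at t)"
      unfolding vec
      by (intro has_vector_derivative_add
          bounded_linear.has_vector_derivative[OF bounded_linear_scaleR_left] e)
    from has_vector_derivative_add[OF
        bounded_linear.has_vector_derivative[OF matrix_vector_mul_bounded_linear this, of "fst g"]
        has_vector_derivative_const]
    show ?thesis by (simp add: h_def)
  qed
  have "c = h 0" using assms by (auto simp: h_def aff_apply_def)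
  then show ?thesis using nth_vector_derivative_eqI[of h n, OF h] by (simp add: h_def)
qed

text \<open>The velocity combines exp(t) and exp(2t), so the coefficients come from (x - 1)(x - 2) =
  x^2 - 3x + 2.\<close>

lemma affine_parabola_ode:
  assumes "\<And>t. c t = aff_apply g (vector [exp t, exp (2 * t)])"
  shows "nth_vector_derivative 3 c t =
    3 *\<^sub>R nth_vector_derivative 2 c t + (-2) *\<^sub>R nth_vector_derivative 1 c t"
  by (simp add: nth_vector_derivative_affine_parabola[OF assms] vec_eq_iff forall_2
      matrix_vector_mult_def sum_2 algebra_simps)

section \<open>Equi-affine and general-affine invariants\<close>

text \<open>Stated for an open interval because the equi-affine curvature is controlled only on the
  range of the arc length.\<close>

lemma interval_integral_has_derivative:
  fixes f :: "real \<Rightarrow> real"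
  assumes "continuous_on J f" "open J" "is_interval J" "y \<in> J" "x \<in> J"
  shows "((\<lambda>u. LBINT v=ereal y..ereal u. f v) has_real_derivative f x) (at x)"
proof -
  define m M where "m = min x y" and "M = max x y"
  have "m \<in> J" "M \<in> J" using assms by (auto simp: m_def M_def min_def max_def)
  \<comment> \<open>Balls around the smaller and the larger point provide a compact interval inside
    \<open>J\<close> with both points in its interior, as the fundamental theorem requires.\<close>
  then obtain a b where a: "a < m" "cball m (m - a) \<subseteq> J" and b: "M < b" "cball M (b - M) \<subseteq> J"
    using \<open>open J\<close> unfolding open_contains_cball
    by (metis add_diff_cancel_left' diff_diff_eq2 diff_gt_0_iff_gt)
  have "a \<in> J" "b \<in> J" using a b by (auto simp: dist_real_def subset_iff)
  then have ab: "{a..b} \<subseteq> J"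
    using \<open>is_interval J\<close> by (meson atLeastAtMost_iff mem_is_interval_1_I subsetI)
  have "((\<lambda>u. LBINT v=ereal y..ereal u. f v) has_vector_derivative f x) (at x within {a..b})"
    using a b continuous_on_subset[OF assms(1) ab]
    by (intro interval_integral_FTC2) (auto simp: m_def M_def)
  moreover have "at x within {a..b} = at x"
    using a b by (intro at_within_Icc_at) (auto simp: m_def M_def)
  ultimately show ?thesis by (simp add: has_real_derivative_iff_has_vector_derivative)
qed

section \<open>Speed of the equi-affine arc length and its derivatives\<close>

locale positive_curve =
  fixes p :: "real \<Rightarrow> real^2"
  assumes smooth: "smooth_on UNIV p"
    and velacc_pos: "\<And>t. velacc_det p t > 0"
begin

abbreviation d :: "nat \<Rightarrow> real \<Rightarrow> real^2" where "d n \<equiv> nth_vector_derivative n p"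
abbreviation D :: "real \<Rightarrow> real" where "D \<equiv> velacc_det p"
abbreviation \<sigma> :: "real \<Rightarrow> real" where "\<sigma> \<equiv> ea_arclength p"
abbreviation \<tau> :: "real \<Rightarrow> real" where "\<tau> \<equiv> inv \<sigma>"

definition w :: "real \<Rightarrow> real" where "w t = D t powr (1/3)"
text \<open>Closed forms of w' and w'': differentiating w^3 = D gives 3 w^2 w' = |c' c'''|, and a
  second differentiation gives \<open>w2\<close>.\<close>

definition w1 :: "real \<Rightarrow> real" where "w1 t = det_cols (d 1 t) (d 3 t) / (3 * w t ^ 2)"
definition w2 :: "real \<Rightarrow> real" where
  "w2 t = (det_cols (d 2 t) (d 3 t) + det_cols (d 1 t) (d 4 t)) / (3 * w t ^ 2) - 2 * w1 t ^ 2 / w t"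

text \<open>\<open>E1\<close>, \<open>E2\<close>, \<open>E3\<close> are the derivatives of \<open>ea_reparam p\<close>, as functions of the original
  parameter.\<close>

definition E1 :: "real \<Rightarrow> real^2" where "E1 t = (1 / w t) *\<^sub>R d 1 t"
definition E2 :: "real \<Rightarrow> real^2" where "E2 t = (1 / w t ^ 2) *\<^sub>R d 2 t - (w1 t / w t ^ 3) *\<^sub>R d 1 t"
definition E3 :: "real \<Rightarrow> real^2" where
  "E3 t = (1 / w t ^ 3) *\<^sub>R d 3 t - (3 * w1 t / w t ^ 4) *\<^sub>R d 2 t
    - (w2 t / w t ^ 4 - 3 * w1 t ^ 2 / w t ^ 5) *\<^sub>R d 1 t"

lemma w_pos: "w t > 0"
  using velacc_pos[of t] by (simp add: w_def)

lemma w_nz: "w t \<noteq> 0"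
  using w_pos[of t] by simp

lemma w_cubed: "w t ^ 3 = D t"
  using velacc_pos[of t] by (simp add: w_def powr_power)

lemma d_derivative: "(d n has_vector_derivative d (Suc n) t) (at t)"
  by (rule smooth_on_has_vector_derivative[OF smooth])

lemma continuous_on_d: "continuous_on A (d n)"
  by (rule continuous_on_vector_derivative[OF d_derivative])

lemma D_derivative: "(D has_real_derivative det_cols (d 1 t) (d 3 t)) (at t)"
proof -
  have "D = (\<lambda>t. det_cols (d 1 t) (d 2 t))" by (rule ext) (simp add: velacc_det_def)
  moreover have "((\<lambda>t. det_cols (d 1 t) (d 2 t)) has_real_derivative
      det_cols (d 1 t) (d (Suc 2) t) + det_cols (d (Suc 1) t) (d 2 t)) (at t)"
    by (rule det_cols_has_derivative[OF d_derivative d_derivative])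
  ultimately show ?thesis by (simp add: det_cols_eq numeral_2_eq_2 numeral_3_eq_3)
qed

lemma w_derivative: "(w has_real_derivative w1 t) (at t)"
proof -
  have "((\<lambda>t. D t powr (1/3)) has_real_derivative
      (1/3) * D t powr (1/3 - 1) * det_cols (d 1 t) (d 3 t)) (at t)"
    using velacc_pos[of t] by (auto intro!: derivative_eq_intros D_derivative)
  moreover have "D t powr (1/3 - 1) = 1 / w t ^ 2"
  proof -
    have "D t powr (1/3 - 1) * w t ^ 2 = 1"
      using velacc_pos[of t] by (simp add: w_def powr_power flip: powr_add)
    then show ?thesis using w_nz[of t] by (simp add: field_simps)
  qed
  ultimately show ?thesis by (simp add: w1_def w_def[abs_def] field_simps)
qed

lemma w1_derivative: "(w1 has_real_derivative w2 t) (at t)"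
proof -
  have "((\<lambda>t. det_cols (d 1 t) (d 3 t)) has_real_derivative
      det_cols (d 1 t) (d (Suc 3) t) + det_cols (d (Suc 1) t) (d 3 t)) (at t)"
    by (rule det_cols_has_derivative[OF d_derivative d_derivative])
  then have "((\<lambda>t. det_cols (d 1 t) (d 3 t)) has_real_derivative
      det_cols (d 1 t) (d 4 t) + det_cols (d 2 t) (d 3 t)) (at t)"
    by (simp add: eval_nat_numeral)
  then have "((\<lambda>t. det_cols (d 1 t) (d 3 t) / (3 * w t ^ 2)) has_real_derivative
     ((det_cols (d 1 t) (d 4 t) + det_cols (d 2 t) (d 3 t)) * (3 * w t ^ 2)
      - det_cols (d 1 t) (d 3 t) * (6 * w t * w1 t)) / ((3 * w t ^ 2) * (3 * w t ^ 2))) (at t)"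
    using w_nz[of t] by (auto intro!: derivative_eq_intros w_derivative)
  moreover have "(\<lambda>t. det_cols (d 1 t) (d 3 t) / (3 * w t ^ 2)) = w1"
    by (simp add: w1_def[abs_def])
  moreover have "det_cols (d 1 t) (d 3 t) = 3 * w t ^ 2 * w1 t"
    using w_nz[of t] by (simp add: w1_def)
  then have "((det_cols (d 1 t) (d 4 t) + det_cols (d 2 t) (d 3 t)) * (3 * w t ^ 2)
      - det_cols (d 1 t) (d 3 t) * (6 * w t * w1 t)) / ((3 * w t ^ 2) * (3 * w t ^ 2)) = w2 t"
    using w_nz[of t] by (simp add: w2_def field_simps eval_nat_numeral)
  ultimately show ?thesis by simp
qed

lemma continuous_on_w: "continuous_on A w"
  by (rule continuous_on_real_derivative[OF w_derivative])

lemma continuous_on_w1: "continuous_on A w1"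
  by (rule continuous_on_real_derivative[OF w1_derivative])

lemma continuous_on_w2: "continuous_on A w2"
  unfolding w2_def[abs_def] using w_nz
  by (intro continuous_intros continuous_on_det_cols continuous_on_d continuous_on_w continuous_on_w1) auto

section \<open>Equi-affine arc length as a change of parameter\<close>

lemma arclength_derivative: "(\<sigma> has_real_derivative w t) (at t)"
proof -
  have "\<sigma> = (\<lambda>t. LBINT u=ereal 0..ereal t. w u)"
    by (rule ext) (simp add: ea_arclength_def w_def)
  then show ?thesis
    using interval_integral_has_derivative[of UNIV w 0 t] continuous_on_w by simp
qed

lemma continuous_on_arclength: "continuous_on A \<sigma>"
  by (rule continuous_on_real_derivative[OF arclength_derivative])

lemma inj_arclength: "inj \<sigma>"
proof -
  have "strict_mono \<sigma>"
    by (rule strict_monoI, rule DERIV_pos_imp_increasing) (use arclength_derivative w_pos in blast)+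
  then show ?thesis by (rule strict_mono_imp_inj_on)
qed

lemma arclength_inverse [simp]: "\<tau> (\<sigma> t) = t"
  by (rule inv_f_f[OF inj_arclength])

lemma arclength_0: "\<sigma> 0 = 0"
  by (simp add: ea_arclength_def)

text \<open>Openness makes two-sided derivatives at arc length values depend only on values on the
  range, where \<open>inv\<close> is a genuine inverse.\<close>

lemma open_range_arclength: "open (range \<sigma>)"
  using injective_eq_1d_open_map_UNIV[of UNIV \<sigma>] continuous_on_arclength inj_arclength by auto

lemma is_interval_range_arclength: "is_interval (range \<sigma>)"
  using connected_continuous_image[OF continuous_on_arclength, of UNIV]
  by (simp add: is_interval_connected_1)

lemma arclength_inverse_derivative: "(\<tau> has_real_derivative 1 / w t) (at (\<sigma> t))"
  unfolding has_field_derivative_def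
  by (rule has_derivative_inverse_strong[where S = UNIV and f' = "(*) (w t)"])
     (use arclength_derivative[of t] continuous_on_arclength w_nz[of t] in
       \<open>auto simp: has_field_derivative_def fun_eq_iff\<close>)

lemma continuous_on_arclength_inverse: "continuous_on (range \<sigma>) \<tau>"
  using arclength_inverse_derivative DERIV_isCont
  by (intro continuous_at_imp_continuous_on) blast

text \<open>Chain rule with the inverse arc length, whose derivative is 1/w. Having the factor
  \<open>w t\<close> in the hypothesis lets the rule be iterated from \<open>p\<close> through
  \<open>E1\<close> and \<open>E2\<close> to \<open>E3\<close>; it also differentiates the
  curvature.\<close>

lemma reparam_derivative:
  assumes f: "\<And>t. f (\<sigma> t) = F t"
    and F: "(F has_vector_derivative w t *\<^sub>R F') (at t)"
  shows "(f has_vector_derivative F') (at (\<sigma> t))"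
proof -
  have "(\<tau> has_vector_derivative 1 / w t) (at (\<sigma> t))"
    using arclength_inverse_derivative by (simp add: has_real_derivative_iff_has_vector_derivative)
  from vector_diff_chain_at[OF this] F
  have "(F \<circ> \<tau> has_vector_derivative F') (at (\<sigma> t))"
    using w_nz[of t] by fastforce
  then show ?thesis
    by (rule has_vector_derivative_transform_within_open[OF _ open_range_arclength])
       (auto simp: f)
qed

section \<open>The equi-affine frame and the curvature\<close>

lemma E1_derivative: "(E1 has_vector_derivative w t *\<^sub>R E2 t) (at t)"
proof -
  have "((\<lambda>t. 1 / w t) has_real_derivative - (w1 t / w t ^ 2)) (at t)"
    using w_nz[of t] by (auto intro!: derivative_eq_intros w_derivative simp: power2_eq_square)
  from has_vector_derivative_scaleR[OF this d_derivative[of 1 t]]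
  show ?thesis
    unfolding E1_def[abs_def] E2_def
    by (rule has_vector_derivative_eq_rhs)
       (use w_nz[of t] in \<open>simp add: vec_eq_iff field_simps eval_nat_numeral\<close>)
qed

lemma E2_derivative: "(E2 has_vector_derivative w t *\<^sub>R E3 t) (at t)"
proof -
  have 1: "((\<lambda>t. 1 / w t ^ 2) has_real_derivative - (2 * w1 t / w t ^ 3)) (at t)"
    using w_nz[of t]
    by (auto intro!: derivative_eq_intros w_derivative simp: field_simps eval_nat_numeral)
  have 2: "((\<lambda>t. w1 t / w t ^ 3) has_real_derivative w2 t / w t ^ 3 - 3 * w1 t ^ 2 / w t ^ 4) (at t)"
    using w_nz[of t]
    by (auto intro!: derivative_eq_intros w_derivative w1_derivative simp: field_simps eval_nat_numeral)
  from has_vector_derivative_diff[OF has_vector_derivative_scaleR[OF 1 d_derivative[of 2 t]]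
      has_vector_derivative_scaleR[OF 2 d_derivative[of 1 t]]]
  show ?thesis
    unfolding E2_def[abs_def] E3_def
    by (rule has_vector_derivative_eq_rhs)
       (use w_nz[of t] in \<open>simp add: vec_eq_iff field_simps eval_nat_numeral\<close>)
qed

lemma continuous_on_E2: "continuous_on A E2"
  by (rule continuous_on_vector_derivative[OF E2_derivative])

lemma continuous_on_E3: "continuous_on A E3"
  unfolding E3_def[abs_def] using w_nz
  by (intro continuous_intros continuous_on_d continuous_on_w continuous_on_w1 continuous_on_w2) auto

lemma
  shows nth1_ea_reparam: "nth_vector_derivative 1 (ea_reparam p) (\<sigma> t) = E1 t"
    and nth3_ea_reparam: "nth_vector_derivative 3 (ea_reparam p) (\<sigma> t) = E3 t"
proof -
  have 0: "ea_reparam p (\<sigma> t) = p t" for t by (simp add: ea_reparam_def)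
  have p: "(p has_vector_derivative w t *\<^sub>R E1 t) (at t)" for t
    using d_derivative[of 0 t] w_nz[of t] by (simp add: nth_vector_derivative_0 E1_def)
  have 1: "nth_vector_derivative 1 (ea_reparam p) (\<sigma> t) = E1 t" for t
    using vector_derivative_at[OF reparam_derivative[OF 0 p]]
    by (simp add: nth_vector_derivative_Suc nth_vector_derivative_0)
  have 2: "nth_vector_derivative 2 (ea_reparam p) (\<sigma> t) = E2 t" for t
    using vector_derivative_at[OF reparam_derivative[OF 1 E1_derivative]]
    by (simp add: nth_vector_derivative_Suc numeral_2_eq_2)
  show "nth_vector_derivative 1 (ea_reparam p) (\<sigma> t) = E1 t"
    "nth_vector_derivative 3 (ea_reparam p) (\<sigma> t) = E3 t"
    using 1 vector_derivative_at[OF reparam_derivative[OF 2 E2_derivative]]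
    by (simp_all add: nth_vector_derivative_Suc[of 2, simplified])
qed

text \<open>The normalization behind the exponent 1/3: the velocity term of \<open>E2\<close> drops
  out and w^3 = D cancels the rest.\<close>

lemma det_E1_E2: "det_cols (E1 t) (E2 t) = 1"
proof -
  have "det_cols (E1 t) (E2 t) = det_cols (d 1 t) (d 2 t) / w t ^ 3"
    using w_nz[of t] by (simp add: E1_def E2_def det_cols_eq field_simps eval_nat_numeral)
  then show ?thesis using w_cubed[of t] velacc_pos[of t] by (simp add: velacc_det_def)
qed

text \<open>This is the arc length derivative of |E1 E2| = 1, checked here by direct computation. It
  makes \<open>E3\<close> a multiple of \<open>E1\<close>.\<close>

lemma det_E1_E3: "det_cols (E1 t) (E3 t) = 0"
proof -
  have "det_cols (E1 t) (E3 t) =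
      (det_cols (d 1 t) (d 3 t) * w t - 3 * w1 t * det_cols (d 1 t) (d 2 t)) / w t ^ 5"
    using w_nz[of t] by (simp add: E1_def E3_def det_cols_eq field_simps eval_nat_numeral)
  moreover have "det_cols (d 1 t) (d 3 t) = 3 * w t ^ 2 * w1 t"
    using w_nz[of t] by (simp add: w1_def)
  moreover have "det_cols (d 1 t) (d 2 t) = w t ^ 3"
    by (simp add: w_cubed velacc_det_def)
  ultimately show ?thesis by (simp add: eval_nat_numeral)
qed

lemma E3_eq: "E3 t = - det_cols (E2 t) (E3 t) *\<^sub>R E1 t"
proof -
  have "det_cols (E3 t) (E2 t) = - det_cols (E2 t) (E3 t)" by (simp add: det_cols_eq)
  then show ?thesis
    using det_cols_cramer[of "E1 t" "E2 t" "E3 t"] by (simp add: det_E1_E2 det_E1_E3)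
qed

text \<open>Replaces the definite description by a formula; uniqueness follows by taking the
  determinant with \<open>E2\<close>.\<close>

lemma ea_curvature_eq: "ea_curvature p (\<sigma> t) = det_cols (E2 t) (E3 t)"
  unfolding ea_curvature_def nth1_ea_reparam nth3_ea_reparam
proof (rule the_equality)
  show "E3 t = - det_cols (E2 t) (E3 t) *\<^sub>R E1 t" by (rule E3_eq)
  fix k assume "E3 t = - k *\<^sub>R E1 t"
  then have "det_cols (E2 t) (E3 t) = k * det_cols (E1 t) (E2 t)"
    by (simp add: det_cols_eq algebra_simps)
  then show "k = det_cols (E2 t) (E3 t)" by (simp add: det_E1_E2)
qed

text \<open>Needed to differentiate the integral that defines \<open>ga_arclength\<close>.\<close>

lemma continuous_on_ea_curvature: "continuous_on (range \<sigma>) (ea_curvature p)"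
proof -
  have "continuous_on (range \<sigma>) (\<lambda>s. det_cols (E2 (\<tau> s)) (E3 (\<tau> s)))"
    by (intro continuous_on_det_cols continuous_on_compose2[OF continuous_on_E2[of UNIV]]
        continuous_on_compose2[OF continuous_on_E3[of UNIV]] continuous_on_arclength_inverse) auto
  then show ?thesis
    by (rule continuous_on_eq) (auto simp: ea_curvature_eq)
qed

text \<open>Common end of the two curvature cases. From w' = m w follows w'' = m^2 w, and E3 = -k E1
  multiplied by w^3 becomes an equation with constant coefficients.\<close>

lemma linear_ode3:
  assumes w1: "\<And>t. w1 t = m * w t"
    and k: "\<And>t. ea_curvature p (\<sigma> t) * w t ^ 2 = b"
  shows "d 3 t = (3 * m) *\<^sub>R d 2 t + (- 2 * m ^ 2 - b) *\<^sub>R d 1 t"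
proof -
  have "w1 = (\<lambda>t. m * w t)" by (rule ext) (rule w1)
  then have "(w1 has_real_derivative m * w1 t) (at t)"
    using DERIV_cmult[OF w_derivative, of m t] by simp
  from DERIV_unique[OF w1_derivative this] have w2: "w2 t = m ^ 2 * w t"
    by (simp add: w1 power2_eq_square)
  have "E3 t = - ea_curvature p (\<sigma> t) *\<^sub>R E1 t" using E3_eq ea_curvature_eq by simp
  then have "w t ^ 3 *\<^sub>R E3 t = w t ^ 3 *\<^sub>R (- ea_curvature p (\<sigma> t) *\<^sub>R E1 t)" by simp
  moreover have "w t ^ 3 *\<^sub>R E3 t = d 3 t - (3 * m) *\<^sub>R d 2 t + (2 * m ^ 2) *\<^sub>R d 1 t"
    using w_nz[of t] by (simp add: E3_def w1 w2 vec_eq_iff field_simps eval_nat_numeral)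
  moreover have "w t ^ 3 *\<^sub>R (- ea_curvature p (\<sigma> t) *\<^sub>R E1 t) = - b *\<^sub>R d 1 t"
    using w_nz[of t] by (simp add: E1_def k[of t, symmetric] eval_nat_numeral)
  ultimately show ?thesis by (simp add: algebra_simps)
qed

lemma linear_ode3_of_constant_ea_curvature:
  assumes "constant_ea_curvature p" "proportional_to_ea_arclength p"
  obtains a b where "\<And>t. d 3 t = a *\<^sub>R d 2 t + b *\<^sub>R d 1 t"
proof -
  obtain \<kappa> where \<kappa>: "\<And>t. ea_curvature p (\<sigma> t) = \<kappa>"
    using assms(1) unfolding constant_ea_curvature_def by blast
  obtain l1 l2 where l: "l1 \<noteq> 0" "\<And>t. t = l1 * \<sigma> t + l2"
    using assms(2) unfolding proportional_to_ea_arclength_def by blast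
  \<comment> \<open>Differentiating the proportionality relation gives l1 w = 1, so the speed is
    constant and m = 0 below.\<close>
  have w: "w t = 1 / l1" for t
  proof -
    have "((\<lambda>t. l1 * \<sigma> t + l2) has_real_derivative l1 * w t) (at t)"
      by (auto intro!: derivative_eq_intros arclength_derivative)
    then have "((\<lambda>t. t) has_real_derivative l1 * w t) (at t)" using l(2) by simp
    then have "l1 * w t = 1" using DERIV_unique[OF DERIV_ident] by fastforce
    then show ?thesis using l(1) by (simp add: field_simps)
  qed
  have "(w has_real_derivative 0) (at t)" for t
    using DERIV_const[of "1 / l1"] by (simp add: w[abs_def])
  then have w1: "w1 t = 0 * w t" for t using DERIV_unique[OF w_derivative] by simp
  have "ea_curvature p (\<sigma> t) * w t ^ 2 = \<kappa> * (1 / l1) ^ 2" for t by (simp add: \<kappa> w)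
  from linear_ode3[OF w1 this] show ?thesis by (rule that)
qed

lemma linear_ode3_of_constant_ga_curvature:
  assumes "ea_curvature_sign_constant p" "constant_ga_curvature p" "proportional_to_ga_arclength p"
  obtains a b where "\<And>t. d 3 t = a *\<^sub>R d 2 t + b *\<^sub>R d 1 t"
proof -
  obtain l1 l2 where l: "l1 \<noteq> 0" "\<And>t. t = l1 * ga_arclength p (\<sigma> t) + l2"
    using assms(3) unfolding proportional_to_ga_arclength_def by blast
  obtain \<kappa> where \<kappa>: "\<And>t. ga_curvature p (\<sigma> t) = \<kappa>"
    using assms(2) unfolding constant_ga_curvature_def by blast
  let ?K = "abs_ea_curvature p"
  have K_cont: "continuous_on (range \<sigma>) (\<lambda>s. sqrt (?K s))"
    unfolding abs_ea_curvature_def[abs_def]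
    by (intro continuous_intros continuous_on_ea_curvature)
  \<comment> \<open>The base point 0 of the integral lies in the range because it is the arc length
    of parameter 0.\<close>
  have G: "(ga_arclength p has_real_derivative sqrt (?K (\<sigma> t))) (at (\<sigma> t))" for t
    unfolding ga_arclength_def[abs_def]
    by (rule interval_integral_has_derivative[OF K_cont open_range_arclength
          is_interval_range_arclength])
       (use arclength_0 in \<open>auto intro: range_eqI[of _ _ 0]\<close>)
  have lw: "l1 * w t * sqrt (?K (\<sigma> t)) = 1" for t
  proof -
    have "((\<lambda>t. l1 * ga_arclength p (\<sigma> t) + l2) has_real_derivative
        l1 * (sqrt (?K (\<sigma> t)) * w t)) (at t)"
      by (auto intro!: derivative_eq_intros DERIV_chain2[OF G arclength_derivative])
    then have "((\<lambda>t. t) has_real_derivative l1 * (sqrt (?K (\<sigma> t)) * w t)) (at t)"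
      using l(2) by simp
    from DERIV_unique[OF DERIV_ident this] show ?thesis by (simp add: mult_ac)
  qed
  \<comment> \<open>Positivity of \<open>l1\<close> is needed to evaluate the real power -3/2 of K =
    (l1 w)^(-2).\<close>
  have "?K s \<ge> 0" for s by (simp add: abs_ea_curvature_def)
  then have "w 0 * sqrt (?K (\<sigma> 0)) \<ge> 0" using w_pos[of 0] by simp
  moreover have "l1 * (w 0 * sqrt (?K (\<sigma> 0))) > 0" using lw[of 0] by (simp add: mult.assoc)
  ultimately have l1: "l1 > 0" by (simp add: zero_less_mult_iff)
  have K: "?K (\<sigma> t) = 1 / (l1 * w t) ^ 2" for t
  proof -
    have "(l1 * w t * sqrt (?K (\<sigma> t))) ^ 2 = 1" by (simp add: lw)
    then show ?thesis
      using l1 w_nz[of t] \<open>?K (\<sigma> t) \<ge> 0\<close> by (simp add: power_mult_distrib field_simps)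
  qed
  \<comment> \<open>With respect to arc length K' = -2 w' / (l1^2 w^4), and K^(-3/2) = (l1 w)^3.
    Their product -2 l1 w'/w is the constant general-affine curvature.\<close>
  have w1: "w1 t = (- \<kappa> / (2 * l1)) * w t" for t
  proof -
    have "((\<lambda>t. 1 / (l1 * w t) ^ 2) has_real_derivative - 2 * w1 t / (l1 ^ 2 * w t ^ 3)) (at t)"
      using l1 w_nz[of t]
      by (auto intro!: derivative_eq_intros w_derivative simp: field_simps eval_nat_numeral)
    then have "((\<lambda>t. 1 / (l1 * w t) ^ 2) has_vector_derivative
        w t *\<^sub>R (- 2 * w1 t / (l1 ^ 2 * w t ^ 4))) (at t)"
      unfolding has_real_derivative_iff_has_vector_derivative
      by (rule has_vector_derivative_eq_rhs)
         (use w_nz[of t] in \<open>simp add: eval_nat_numeral mult.assoc\<close>)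
    from reparam_derivative[OF K this]
    have "deriv ?K (\<sigma> t) = - 2 * w1 t / (l1 ^ 2 * w t ^ 4)"
      by (simp add: DERIV_imp_deriv has_real_derivative_iff_has_vector_derivative)
    moreover have "?K (\<sigma> t) powr (-3/2) = (l1 * w t) ^ 3"
    proof -
      have "?K (\<sigma> t) = (l1 * w t) powr (-2)"
        using l1 w_pos[of t] by (simp add: K powr_minus_divide)
      then show ?thesis using l1 w_pos[of t] by (simp add: powr_powr)
    qed
    ultimately have "- 2 * w1 t / (l1 ^ 2 * w t ^ 4) * (l1 * w t) ^ 3 = \<kappa>"
      using \<kappa>[of t] by (simp add: ga_curvature_def)
    then show ?thesis using l1 w_nz[of t] by (simp add: field_simps eval_nat_numeral)
  qed
  \<comment> \<open>Here \<open>e\<close> is 1 or -1, the constant sign of the curvature.\<close>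
  from assms(1) obtain e where "\<And>t. ea_curvature p (\<sigma> t) = e * ?K (\<sigma> t)"
    unfolding ea_curvature_sign_constant_def
  proof
    assume "\<forall>s\<in>range \<sigma>. ea_curvature p s > 0"
    then show ?thesis by (intro that[of 1]) (simp add: abs_ea_curvature_def abs_of_pos)
  next
    assume "\<forall>s\<in>range \<sigma>. ea_curvature p s < 0"
    then show ?thesis by (intro that[of "-1"]) (simp add: abs_ea_curvature_def abs_of_neg)
  qed
  then have "ea_curvature p (\<sigma> t) * w t ^ 2 = e / l1 ^ 2" for t
    using l1 w_nz[of t] by (simp add: K power_mult_distrib)
  from linear_ode3[OF w1 this] show ?thesis by (rule that)
qed

end

section \<open>Reversal of orientation\<close>

lemma nth_vector_derivative_reflect:
  fixes f :: "real \<Rightarrow> 'a::real_normed_vector"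
  assumes "smooth_on UNIV f"
  shows "nth_vector_derivative n (\<lambda>t. f (- t)) t = (- 1) ^ n *\<^sub>R nth_vector_derivative n f (- t)"
  using nth_vector_derivative_scale[OF assms, of n "-1"] by simp

lemma velacc_det_reflect:
  assumes "smooth_on UNIV c"
  shows "velacc_det (\<lambda>t. c (- t)) t = - velacc_det c (- t)"
  by (simp add: velacc_det_def nth_vector_derivative_reflect[OF assms] det_cols_eq)

text \<open>A continuous non-vanishing determinant has constant sign. If it is not positive
  everywhere it is negative everywhere, and reflection flips it.\<close>

lemma pos_oriented_positive_curve:
  assumes smooth: "smooth_on UNIV c" and "ea_regular c"
  shows "positive_curve (pos_oriented c)"
proof (cases "\<forall>t. velacc_det c t > 0")
  case True
  then show ?thesis using smooth by unfold_locales (auto simp: pos_oriented_def)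
next
  case False
  have nz: "velacc_det c t \<noteq> 0" for t using assms(2) by (simp add: ea_regular_def)
  have "continuous_on UNIV (nth_vector_derivative n c)" for n
    by (rule continuous_on_vector_derivative[OF smooth_on_has_vector_derivative[OF smooth]])
  then have "continuous_on UNIV (velacc_det c)"
    unfolding velacc_det_def[abs_def] by (intro continuous_on_det_cols)
  then have "is_interval (range (velacc_det c))"
    using connected_continuous_image by (auto simp: is_interval_connected_1)
  moreover obtain t0 where "velacc_det c t0 \<le> 0" using False by (auto simp: not_less)
  ultimately have "velacc_det c t < 0" for t
    using nz mem_is_interval_1_I[of "range (velacc_det c)" "velacc_det c t0" "velacc_det c t" 0]
    by (metis image_iff linorder_not_less rangeI)
  then have "velacc_det (\<lambda>t. c (- t)) t > 0" for t
    by (simp add: velacc_det_reflect[OF smooth])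
  moreover have "smooth_on UNIV (\<lambda>t. c (- t))" using smooth_on_scale[OF smooth, of "-1"] by simp
  ultimately show ?thesis
    using False by unfold_locales (auto simp: pos_oriented_def)
qed

text \<open>Reflection changes the sign of the odd derivatives only, so \<open>a\<close> changes
  sign and \<open>b\<close> is kept.\<close>

lemma linear_ode3_of_pos_oriented:
  assumes smooth: "smooth_on UNIV c"
    and ode: "\<And>t. nth_vector_derivative 3 (pos_oriented c) t =
      a *\<^sub>R nth_vector_derivative 2 (pos_oriented c) t + b *\<^sub>R nth_vector_derivative 1 (pos_oriented c) t"
  obtains a' b' where "\<And>t. nth_vector_derivative 3 c t =
      a' *\<^sub>R nth_vector_derivative 2 c t + b' *\<^sub>R nth_vector_derivative 1 c t"
proof (cases "\<forall>t. velacc_det c t > 0")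
  case True
  then show ?thesis using ode that by (simp add: pos_oriented_def)
next
  case False
  have "nth_vector_derivative 3 c t =
      (- a) *\<^sub>R nth_vector_derivative 2 c t + b *\<^sub>R nth_vector_derivative 1 c t" for t
  proof -
    have "- nth_vector_derivative 3 c t =
      a *\<^sub>R nth_vector_derivative 2 c t + b *\<^sub>R (- nth_vector_derivative 1 c t)"
      using ode[of "- t"]
      unfolding pos_oriented_def if_not_P[OF False] nth_vector_derivative_reflect[OF smooth] by simp
    then have "nth_vector_derivative 3 c t = -
      (a *\<^sub>R nth_vector_derivative 2 c t + b *\<^sub>R (- nth_vector_derivative 1 c t))"
      by (metis minus_minus)
    then show ?thesis by simp
  qed
  then show ?thesis by (rule that)
qed

theorem theorem4:
  fixes c :: "real \<Rightarrow> real^2"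
  assumes "smooth_on UNIV c"
    and "lin_indep_pair (nth_vector_derivative 1 c 0) (nth_vector_derivative 2 c 0)"
    and "(ea_regular c \<and>
            constant_ea_curvature (pos_oriented c) \<and>
            proportional_to_ea_arclength (pos_oriented c))
       \<or> (\<exists>g\<in>Aff2. \<forall>t. c t = aff_apply g (vector [exp t, exp (2 * t)]))
       \<or> (ea_regular c \<and>
            ea_curvature_sign_constant (pos_oriented c) \<and>
            constant_ga_curvature (pos_oriented c) \<and>
            proportional_to_ga_arclength (pos_oriented c))"
  shows "(\<forall>\<alpha>\<in>{0<..<1}. soliton \<alpha> c) \<and> soliton (1/2) c"
proof -
  obtain a b where "\<And>t. nth_vector_derivative 3 c t =
      a *\<^sub>R nth_vector_derivative 2 c t + b *\<^sub>R nth_vector_derivative 1 c t"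
    using assms(3)
  proof (elim disjE conjE bexE)
    assume "ea_regular c" and *: "constant_ea_curvature (pos_oriented c)"
      "proportional_to_ea_arclength (pos_oriented c)"
    interpret positive_curve "pos_oriented c"
      by (rule pos_oriented_positive_curve) fact+
    show ?thesis
      using linear_ode3_of_constant_ea_curvature[OF *] linear_ode3_of_pos_oriented[OF assms(1)] that
      by metis
  next
    fix g assume "\<forall>t. c t = aff_apply g (vector [exp t, exp (2 * t)])"
    then show ?thesis using affine_parabola_ode that by blast
  next
    assume "ea_regular c" and *: "ea_curvature_sign_constant (pos_oriented c)"
      "constant_ga_curvature (pos_oriented c)" "proportional_to_ga_arclength (pos_oriented c)"
    interpret positive_curve "pos_oriented c"
      by (rule pos_oriented_positive_curve) fact+
    show ?thesis
      using linear_ode3_of_constant_ga_curvature[OF *] linear_ode3_of_pos_oriented[OF assms(1)] that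
      by metis
  qed
  from soliton_of_linear_ode3[OF assms(1,2) this] show ?thesis by blast
qed

end
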